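(* Let $\mathbb{D}_{n,s}$ be a positive basis of $\mathbb{R}^n$ contained in $\Omega$. For each basis $\mathbb{B}_n$ of $\mathbb{R}^n$ contained in $\mathbb{D}_{n,s}$, let $$\gamma_{\mathbb{B}_n}=\frac{1}{\sqrt{\mathbf{1}^\top \mathbf{G}(\mathbb{B}_n)^{-1}\mathbf{1}}}$$ and let $u_{\mathbb{B}_n}=\gamma_{\mathbb{B}_n}\mathbb{B}_n^{-\top}\mathbf{1}$ be the unit vector such that $u_{\mathbb{B}_n}^\top\mathbb{B}_n=\gamma_{\mathbb{B}_n}\mathbf{1}^\top$. Then, for every such basis $\mathbb{B}_n$, $$u_{\mathbb{B}_n}^\top d\le 0\quad\text{for all } d\in\mathbb{D}_{n,s}\setminus\mathbb{B}_n.$$ Consequently, $$\mathrm{cm}(\mathbb{D}_{n,s})=\min_{\mathbb{B}_n\subset\mathbb{D}_{n,s}}\gamma_{\mathbb{B}_n}$$ and the cosine vector set of $\mathbb{D}_{n,s}$ is $$c\mathbf{V}(\mathbb{D}_{n,s})=\{u_{\mathbb{B}_n}:\ \mathbb{B}_n\subset\mathbb{D}_{n,s},\ \gamma_{\mathbb{B}_n}=\mathrm{cm}(\mathbb{D}_{n,s})\},$$ where $\mathbb{B}_n$ ranges over all bases of $\mathbb{R}^n$ contained in $\mathbb{D}_{n,s}$.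
   Context: Sets of vectors are identified with matrices whose columns are the vectors. $\mathbf{1}$ is the all-ones vector and $\mathbf{G}(S)=S^\top S$ is the Gram matrix of $S$; $\mathbb{B}_n^{-\top}$ is the inverse of the transpose of $\mathbb{B}_n$. The positive span $\mathrm{pspan}(S)$ of a finite set $S$ of vectors is the set of linear combinations of elements of $S$ with nonnegative coefficients. A finite set $S$ is positively independent if $d\notin\mathrm{pspan}(S\setminus\{d\})$ for all $d\in S$. A positive basis of a subspace $L$ of $\mathbb{R}^n$ is a positively independent set with positive span equal to $L$. All vectors in positive bases are assumed to be unit vectors. A positive basis of $\mathbb{R}^n$ of size $s$ is written $\mathbb{D}_{n,s}$; necessarily $n+1\le s\le 2n$. A positive basis of an $m$-dimensional space is minimal if it has $m+1$ elements. A sub-positive basis of a subspace $L$ is a subset of a positive basis of $\mathbb{R}^n$ with positive span equal to $L$; $\mathbb{D}^n_m$ denotes a minimal sub-positive basis (size $m+1$) of an $m$-dimensional subspace. The cosine measure of a finite set $S$ of non-zero vectors of $\mathbb{R}^n$ is $\mathrm{cm}(S)=\min_{u\in\mathbb{R}^n,\|u\|=1}\max_{d\in S}\frac{u^\top d}{\|d\|}$, and the cosine vector set $c\mathbf{V}(S)$ is the set of unit vectors $u$ attaining this minimum. $\Omega$ (for given $n,s$) is the set of positive bases $\mathbb{D}_{n,s}$ of $\mathbb{R}^n$ that admit a partition $\mathbb{D}_{n,s}=\mathbb{D}^n_{m_1}\cup\dots\cup\mathbb{D}^n_{m_{s-n}}$, where $\mathbb{D}^n_{m_i}$ is a minimal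 sub-positive basis of a subspace $L_i$ with $1\le\dim L_i=m_i\le n$, $\mathbb{R}^n=L_1\oplus\dots\oplus L_{s-n}$, and $L_i\cap L_j=\{0\}$ for $i\ne j$. *)

theory Defs
  imports "HOL-Analysis.Analysis"
begin

definition pspan :: "'a::real_vector set \<Rightarrow> 'a set" where
  "pspan S = {\<Sum>d\<in>S. c d *\<^sub>R d | c. \<forall>d\<in>S. 0 \<le> c d}"

definition positively_independent :: "'a::real_vector set \<Rightarrow> bool" where
  "positively_independent S \<longleftrightarrow> (\<forall>d\<in>S. d \<notin> pspan (S - {d}))"

definition positive_basis :: "'a::euclidean_space set \<Rightarrow> 'a set \<Rightarrow> bool" where
  "positive_basis L S \<longleftrightarrow>
     subspace L \<and> finite S \<and> (\<forall>d\<in>S. norm d = 1) \<and>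
     positively_independent S \<and> pspan S = L"

definition sub_positive_basis :: "'a::euclidean_space set \<Rightarrow> 'a set \<Rightarrow> bool" where
  "sub_positive_basis L S \<longleftrightarrow>
     subspace L \<and> (\<exists>P. positive_basis UNIV P \<and> S \<subseteq> P) \<and> pspan S = L"

definition minimal_sub_positive_basis :: "'a::euclidean_space set \<Rightarrow> 'a set \<Rightarrow> bool" where
  "minimal_sub_positive_basis L S \<longleftrightarrow> sub_positive_basis L S \<and> card S = dim L + 1"

text \<open>The whole space is the internal direct sum of the family \<open>L\<close> over \<open>I\<close>. The families
  \<open>f\<close> are taken extensional (\<open>Pi\<^sub>E\<close>) so that uniqueness concerns only indices in \<open>I\<close>.\<close>

definition is_direct_sum :: "'i set \<Rightarrow> ('i \<Rightarrow> 'a::real_vector set) \<Rightarrow> bool" where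
  "is_direct_sum I L \<longleftrightarrow>
     (\<forall>i\<in>I. subspace (L i)) \<and> (\<forall>x. \<exists>!f. f \<in> Pi\<^sub>E I L \<and> x = (\<Sum>i\<in>I. f i))"

text \<open>The subtraction \<open>s - CARD('n)\<close> never truncates to \<open>0\<close> on a member of \<open>Omega s\<close>: the
  partition would be empty, but the empty set does not positively span the space. The
  blocks are nonempty because \<open>card (P i) = dim (L i) + 1\<close>.\<close>

definition Omega :: "nat \<Rightarrow> (real^'n) set set" where
  "Omega s = {D. positive_basis UNIV D \<and> card D = s \<and>
     (\<exists>P L. let I = {1..s - CARD('n)} in
        D = (\<Union>i\<in>I. P i) \<and> disjoint_family_on P I \<and>
        (\<forall>i\<in>I. minimal_sub_positive_basis (L i) (P i) \<and>
                1 \<le> dim (L i) \<and> dim (L i) \<le> CARD('n)) \<and>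
        is_direct_sum I L \<and>
        (\<forall>i\<in>I. \<forall>j\<in>I. i \<noteq> j \<longrightarrow> L i \<inter> L j = {0}))}"

definition max_cosine :: "'a::euclidean_space set \<Rightarrow> 'a \<Rightarrow> real" where
  "max_cosine S u = Max ((\<lambda>d. (u \<bullet> d) / norm d) ` S)"

definition cosine_measure :: "'a::euclidean_space set \<Rightarrow> real" where
  "cosine_measure S = (INF u\<in>sphere 0 1. max_cosine S u)"

definition cosine_vector_set :: "'a::euclidean_space set \<Rightarrow> 'a set" where
  "cosine_vector_set S = {u. norm u = 1 \<and> max_cosine S u = cosine_measure S}"

text \<open>The infimum defining the cosine measure is a minimum.\<close>

lemma continuous_on_max_cosine:
  assumes "finite S" "S \<noteq> {}"
  shows "continuous_on A (max_cosine S)"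
  using assms
proof (induction S rule: finite_ne_induct)
  case (singleton d)
  then show ?case
    by (auto simp: max_cosine_def divide_inverse intro!: continuous_intros)
next
  case (insert d S)
  have "max_cosine (insert d S) = (\<lambda>u. max ((u \<bullet> d) / norm d) (max_cosine S u))"
    using insert.hyps by (simp add: max_cosine_def fun_eq_iff)
  moreover have "continuous_on A (\<lambda>u. (u \<bullet> d) / norm d)"
    by (auto simp: divide_inverse intro!: continuous_intros)
  ultimately show ?case
    using insert.IH by (simp add: continuous_on_max)
qed

lemma cosine_measure_attained:
  fixes S :: "'a::euclidean_space set"
  assumes "finite S" "S \<noteq> {}"
  obtains u where "norm u = 1" "max_cosine S u = cosine_measure S"
    "\<And>v. norm v = 1 \<Longrightarrow> max_cosine S u \<le> max_cosine S v"
proof -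
  have "sphere (0::'a) 1 \<noteq> {}"
    by simp
  then obtain u where u: "u \<in> sphere 0 1"
    "\<forall>v\<in>sphere 0 1. max_cosine S u \<le> max_cosine S v"
    using continuous_attains_inf[OF compact_sphere _ continuous_on_max_cosine[OF assms]]
    by blast
  have "cosine_measure S = max_cosine S u"
    unfolding cosine_measure_def by (rule cInf_eq_minimum) (use u in auto)
  with u show thesis
    by (intro that[of u]) auto
qed

text \<open>A basis of the space is identified with a matrix whose columns are its elements. A square
  matrix whose columns span the space has pairwise distinct columns, so these are exactly
  the enumerations, without repetition, of the bases contained in \<open>D\<close>.\<close>

definition bases_in :: "(real^'n) set \<Rightarrow> (real^'n^'n) set" where
  "bases_in D = {B. columns B \<subseteq> D \<and> independent (columns B) \<and> span (columns B) = UNIV}"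

definition gram :: "real^'n^'m \<Rightarrow> real^'n^'n" where
  "gram S = transpose S ** S"

definition basis_gamma :: "real^'n^'n \<Rightarrow> real" where
  "basis_gamma B = 1 / sqrt (vec 1 \<bullet> (matrix_inv (gram B) *v vec 1))"

definition basis_vector :: "real^'n^'n \<Rightarrow> real^'n" where
  "basis_vector B = basis_gamma B *\<^sub>R (matrix_inv (transpose B) *v vec 1)"

text \<open>Every basis contained in \<open>D\<close> arises from some matrix, and the quantities attached to it do
  not depend on the order of the columns.\<close>

lemma columns_bases_in:
  fixes D :: "(real^'n) set"
  shows "columns ` bases_in D = {S. S \<subseteq> D \<and> independent S \<and> span S = UNIV}"
proof (intro equalityI subsetI)
  fix S assume "S \<in> {S. S \<subseteq> D \<and> independent S \<and> span S = UNIV}"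
  then have S: "S \<subseteq> D" "independent S" "span S = UNIV"
    by auto
  have "card S = CARD('n)"
    using S(2,3) by (metis dim_UNIV DIM_cart DIM_real mult_1_right dim_span dim_eq_card_independent)
  then obtain h :: "'n \<Rightarrow> real^'n" where h: "bij_betw h UNIV S"
    using S(2) by (metis finite_same_card_bij finite independent_imp_finite)
  define B :: "real^'n^'n" where "B = (\<chi> i j. h j $ i)"
  have "column j B = h j" for j
    by (simp add: column_def B_def vec_eq_iff)
  then have "columns B = S"
    using h by (auto simp: columns_def bij_betw_def)
  with S show "S \<in> columns ` bases_in D"
    by (auto simp: bases_in_def)
qed (auto simp: bases_in_def)

lemma basis_quantities:
  fixes B :: "real^'n^'n"
  assumes "span (columns B) = UNIV"
  shows "vec 1 \<bullet> (matrix_inv (gram B) *v vec 1) = (norm (matrix_inv (transpose B) *v vec 1))\<^sup>2"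
    and "\<forall>d\<in>columns B. (matrix_inv (transpose B) *v vec 1) \<bullet> d = 1"
proof -
  obtain C where BC: "B ** C = mat 1" "C ** B = mat 1"
    using assms matrix_right_invertible_span_columns[of B] matrix_left_right_inverse
    by (metis span_vec_eq)
  have tr: "transpose B ** transpose C = mat 1" "transpose C ** transpose B = mat 1"
    using BC by (metis matrix_transpose_mul transpose_mat)+
  have uniq: "matrix_inv X = Y" if "X ** Y = mat 1" "Y ** X = mat 1" for X Y :: "real^'n^'n"
    using that 
    by (metis (mono_tags, lifting) matrix_inv_def matrix_mul_assoc matrix_mul_lid matrix_mul_rid someI)
  have t: "matrix_inv (transpose B) = transpose C"
    using uniq tr by blast
  have "gram B ** (C ** transpose C) = mat 1"
    unfolding gram_def using BC tr by (metis matrix_mul_assoc matrix_mul_rid)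
  moreover from this have "(C ** transpose C) ** gram B = mat 1"
    using matrix_left_right_inverse by blast
  ultimately have g: "matrix_inv (gram B) = C ** transpose C"
    using uniq by blast
  show "vec 1 \<bullet> (matrix_inv (gram B) *v vec 1) = (norm (matrix_inv (transpose B) *v vec 1))\<^sup>2"
    by (simp add: g t power2_norm_eq_inner dot_lmul_matrix flip: matrix_vector_mul_assoc)
  have "transpose B *v (matrix_inv (transpose B) *v vec 1) = vec 1"
    unfolding t matrix_vector_mul_assoc tr by (rule matrix_vector_mul_lid)
  then show "\<forall>d\<in>columns B. (matrix_inv (transpose B) *v vec 1) \<bullet> d = 1"
    by (auto simp: columns_def column_def transpose_def matrix_vector_mult_def vec_eq_iff
        inner_vec_def mult.commute)
qed

lemma basis_quantities_cong:
  fixes B B' :: "real^'n^'n"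
  assumes "span (columns B) = UNIV" "columns B = columns B'"
  shows "basis_gamma B = basis_gamma B'" "basis_vector B = basis_vector B'"
proof -
  let ?w = "matrix_inv (transpose B) *v vec 1 :: real^'n"
    and ?w' = "matrix_inv (transpose B') *v vec 1 :: real^'n"
  have B': "span (columns B') = UNIV"
    using assms by simp
  have "(?w - ?w') \<bullet> d = 0" if "d \<in> columns B" for d
    using basis_quantities(2)[OF assms(1)] basis_quantities(2)[OF B'] that assms(2)
    by (simp add: inner_diff_left)
  then have "(?w - ?w') \<bullet> x = 0" for x
    using assms(1) orthogonal_to_span[of x "columns B" "?w - ?w'"]
    by (simp add: orthogonal_def)
  then have w: "?w = ?w'"
    by (metis inner_eq_zero_iff right_minus_eq)
  show g: "basis_gamma B = basis_gamma B'"
    unfolding basis_gamma_def basis_quantities(1)[OF assms(1)] basis_quantities(1)[OF B'] w ..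
  show "basis_vector B = basis_vector B'"
    unfolding basis_vector_def g w ..
qed

end

theory Submission
  imports Defs
begin

text \<open>
  The sign condition is a statement about one block of the partition at a time. Uniqueness of
  decompositions in \<open>L\<^sub>1 \<oplus> \<dots> \<oplus> L\<^sub>k\<close> forces a basis \<open>B \<subseteq> D\<close> to span every summand
  \<open>L\<^sub>i\<close> already with \<open>B \<inter> P\<^sub>i\<close>. As \<open>P\<^sub>i\<close> has only \<open>dim L\<^sub>i + 1\<close> elements, \<open>B\<close> omits at most one
  of them (\<open>block_minus_spanning_subset\<close>). A set whose positive span is a subspace has a
  vanishing linear combination with all coefficients positive (\<open>positive_relation\<close>), so an
  omitted element \<open>d\<close> is a combination of the rest of its block with negative coefficients. All of these lie in
  \<open>B\<close>, where \<open>u\<^sub>B\<close> has the constant positive inner product \<open>\<gamma>\<^sub>B\<close>; hence \<open>u\<^sub>B \<bullet> d \<le> 0\<close>.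

  Consequently \<open>u\<^sub>B\<close> has largest cosine exactly \<open>\<gamma>\<^sub>B\<close>, and the cosine measure is at most
  every \<open>\<gamma>\<^sub>B\<close>. Conversely, at a minimiser \<open>u\<close> the elements of \<open>D\<close> attaining the maximum span
  the whole space (\<open>active_set_spans\<close>): otherwise \<open>u\<close> could be moved in a direction orthogonal
  to them, which makes it longer without increasing the maximal inner product, so that
  normalising it would lower the maximal cosine. The active set thus contains a basis
  \<open>B\<close>, and \<open>u = u\<^sub>B\<close> because a unit vector with constant positive inner product on a basis is
  unique (\<open>basis_vector_unique\<close>). So every minimiser is some \<open>u\<^sub>B\<close>, and the minimum is its
  \<open>\<gamma>\<^sub>B\<close>.
\<close>

section \<open>Positive spans and direct sums\<close>

lemma superset_pspan:
  assumes "finite S"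
  shows "S \<subseteq> pspan S"
proof
  fix d assume d: "d \<in> S"
  have "(\<Sum>e\<in>S. (if e = d then 1 else 0) *\<^sub>R e) = (\<Sum>e\<in>S. if e = d then e else 0)"
    by (rule sum.cong) auto
  then have "d = (\<Sum>e\<in>S. (if e = d then 1 else 0) *\<^sub>R e)"
    using assms d by simp
  then show "d \<in> pspan S"
    unfolding pspan_def by (auto intro!: exI[of _ "\<lambda>e. if e = d then 1 else 0"])
qed

text \<open>The negative of the sum of all elements lies in the positive span; adding the sum back
  raises every coefficient to at least \<open>1\<close>.\<close>

lemma positive_relation:
  assumes "finite S" "subspace (pspan S)"
  obtains c where "\<And>d. d \<in> S \<Longrightarrow> 0 < c d" "(\<Sum>d\<in>S. c d *\<^sub>R d) = 0"
proof -
  have "- (\<Sum>d\<in>S. d) \<in> pspan S"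
    using superset_pspan[OF assms(1)] assms(2)
    by (intro subspace_neg subspace_sum) auto
  then obtain a where a: "\<And>d. d \<in> S \<Longrightarrow> 0 \<le> a d" "- (\<Sum>d\<in>S. d) = (\<Sum>d\<in>S. a d *\<^sub>R d)"
    unfolding pspan_def by auto
  have "(\<Sum>d\<in>S. (a d + 1) *\<^sub>R d) = (\<Sum>d\<in>S. a d *\<^sub>R d) + (\<Sum>d\<in>S. d)"
    by (simp add: scaleR_left_distrib sum.distrib)
  also have "\<dots> = 0"
    using a(2) by (metis add.left_inverse)
  finally show thesis
    using a(1) by (intro that[of "\<lambda>d. a d + 1"]) (auto simp: add_nonneg_pos)
qed

text \<open>An element of the intersection has two decompositions: itself in component \<open>i\<close>, and one
  whose component \<open>i\<close> is zero.\<close>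

lemma direct_sum_Int_span_others:
  assumes "finite I" "is_direct_sum I L" "i \<in> I"
  shows "L i \<inter> span (\<Union>j\<in>I - {i}. L j) \<subseteq> {0}"
proof
  have sub: "subspace (L j)" if "j \<in> I" for j
    using assms(2) that by (auto simp: is_direct_sum_def)
  define M where "M = {\<Sum>j\<in>I. f j | f. f i = 0 \<and> (\<forall>j\<in>I. f j \<in> L j)}"
  have "subspace M"
    unfolding subspace_def
  proof (intro conjI ballI allI)
    show "0 \<in> M"
      unfolding M_def using sub by (auto intro!: exI[of _ "\<lambda>_. 0"] simp: subspace_0)
  next
    fix x y assume "x \<in> M" "y \<in> M"
    then obtain f g where "f i = 0" "\<forall>j\<in>I. f j \<in> L j" "x = (\<Sum>j\<in>I. f j)"
      "g i = 0" "\<forall>j\<in>I. g j \<in> L j" "y = (\<Sum>j\<in>I. g j)"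
      unfolding M_def by auto
    then show "x + y \<in> M"
      unfolding M_def using sub
      by (auto intro!: exI[of _ "\<lambda>j. f j + g j"] simp: sum.distrib subspace_add)
  next
    fix c x assume "x \<in> M"
    then obtain f where "f i = 0" "\<forall>j\<in>I. f j \<in> L j" "x = (\<Sum>j\<in>I. f j)"
      unfolding M_def by auto
    then show "c *\<^sub>R x \<in> M"
      unfolding M_def using sub
      by (auto intro!: exI[of _ "\<lambda>j. c *\<^sub>R f j"] simp: scaleR_sum_right subspace_scale)
  qed
  moreover have "(\<Union>j\<in>I - {i}. L j) \<subseteq> M"
  proof
    fix x assume "x \<in> (\<Union>j\<in>I - {i}. L j)"
    then obtain j where "j \<in> I" "j \<noteq> i" "x \<in> L j"
      by auto
    then show "x \<in> M"
      unfolding M_def using sub assms(1)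
      by (auto intro!: exI[of _ "\<lambda>k. if k = j then x else 0"] simp: subspace_0)
  qed
  ultimately have span_M: "span (\<Union>j\<in>I - {i}. L j) \<subseteq> M"
    by (rule span_minimal[rotated])
  fix x assume x: "x \<in> L i \<inter> span (\<Union>j\<in>I - {i}. L j)"
  then obtain f where f: "f i = 0" "\<forall>j\<in>I. f j \<in> L j" "x = (\<Sum>j\<in>I. f j)"
    using span_M unfolding M_def by auto
  define g where "g = (\<lambda>k. if k = i then x else 0)"
  have g: "\<forall>j\<in>I. g j \<in> L j" "x = (\<Sum>j\<in>I. g j)"
    using x sub assms(1,3) by (auto simp: g_def subspace_0)
  \<comment> \<open>Uniqueness is formulated for extensional families, hence the restrictions to \<open>I\<close>.\<close>
  have "restrict f I \<in> Pi\<^sub>E I L" "x = (\<Sum>j\<in>I. restrict f I j)"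
       "restrict g I \<in> Pi\<^sub>E I L" "x = (\<Sum>j\<in>I. restrict g I j)"
    using f g by auto
  then have "restrict f I = restrict g I"
    using assms(2) unfolding is_direct_sum_def by blast
  then have "f i = g i"
    using assms(3) by (metis restrict_apply')
  then show "x \<in> {0}"
    using f(1) by (simp add: g_def)
qed

text \<open>Writing an element of \<open>L i\<close> in terms of \<open>B\<close>, the contribution of the other blocks lies in
  \<open>L i\<close> as well and so vanishes. Hence \<open>B \<inter> P i\<close> spans \<open>L i\<close> and has at least \<open>dim (L i)\<close>
  elements, one less than \<open>P i\<close>.\<close>

lemma block_minus_spanning_subset:
  fixes P :: "'i \<Rightarrow> 'a::euclidean_space set"
  assumes "finite I" "is_direct_sum I L"
    and block: "\<And>j. j \<in> I \<Longrightarrow> finite (P j) \<and> P j \<subseteq> L j"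
    and i: "i \<in> I" "card (P i) = dim (L i) + 1"
    and B: "B \<subseteq> (\<Union>j\<in>I. P j)" "span B = UNIV"
    and d: "d \<in> P i" "d \<notin> B"
  shows "P i - {d} \<subseteq> B"
proof -
  have sub: "subspace (L i)"
    using assms(2) i(1) by (auto simp: is_direct_sum_def)
  have "L i \<subseteq> span (B \<inter> P i)"
  proof
    fix x assume x: "x \<in> L i"
    have "x \<in> span ((B \<inter> P i) \<union> (B - P i))"
      using B(2) by (simp add: Int_Diff_Un)
    then obtain y z where yz: "y \<in> span (B \<inter> P i)" "z \<in> span (B - P i)" "x = y + z"
      unfolding span_Un by auto
    have "y \<in> L i"
      using yz(1) span_minimal[OF _ sub] block[OF i(1)] by blast
    then have "z \<in> L i"
      using subspace_diff[OF sub x] yz(3) by fastforce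
    moreover have "B - P i \<subseteq> (\<Union>j\<in>I - {i}. L j)"
      using B(1) block by blast
    then have "z \<in> span (\<Union>j\<in>I - {i}. L j)"
      using yz(2) span_mono by blast
    ultimately have "z = 0"
      using direct_sum_Int_span_others[OF assms(1,2) i(1)] by blast
    then show "x \<in> span (B \<inter> P i)"
      using yz by simp
  qed
  then have "dim (L i) \<le> card (B \<inter> P i)"
    using block[OF i(1)] by (intro dim_le_card) auto
  then have "card (P i - {d}) \<le> card (B \<inter> P i)"
    using i(2) d(1) block[OF i(1)] by simp
  moreover have "B \<inter> P i \<subseteq> P i - {d}"
    using d(2) by auto
  ultimately have "B \<inter> P i = P i - {d}"
    using block[OF i(1)] by (intro card_seteq) auto
  then show ?thesis
    by auto
qed

section \<open>The sign condition\<close>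

lemma Omega_positive_basis: "D \<in> Omega s \<Longrightarrow> positive_basis UNIV D"
  by (simp add: Omega_def)

text \<open>In the vanishing positive combination of the block of \<open>d\<close>, every other element lies in \<open>B\<close>
  and contributes a nonnegative inner product with \<open>u\<close>, so the term of \<open>d\<close> must compensate.\<close>

lemma inner_nonpos_outside_basis:
  fixes D :: "(real^'n) set"
  assumes D: "D \<in> Omega s"
    and B: "B \<subseteq> D" "span B = UNIV"
    and u: "\<And>b. b \<in> B \<Longrightarrow> u \<bullet> b = g" "0 \<le> g"
    and d: "d \<in> D - B"
  shows "u \<bullet> d \<le> 0"
proof -
  define I where "I = {1..s - CARD('n)}"
  obtain P L where PL: "D = (\<Union>i\<in>I. P i)" "is_direct_sum I L"
      "\<And>i. i \<in> I \<Longrightarrow> minimal_sub_positive_basis (L i) (P i)"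
    using D unfolding Omega_def Let_def I_def[symmetric] by auto
  have block: "finite (P j) \<and> P j \<subseteq> L j" "subspace (L j)" "pspan (P j) = L j"
      "card (P j) = dim (L j) + 1" if "j \<in> I" for j
    using PL(3)[OF that] superset_pspan[of "P j"]
    by (auto simp: minimal_sub_positive_basis_def sub_positive_basis_def positive_basis_def
        intro: finite_subset)
  obtain i where i: "i \<in> I" "d \<in> P i"
    using PL(1) d by auto
  have rest: "P i - {d} \<subseteq> B"
    using block_minus_spanning_subset[OF _ PL(2) block(1) i(1) block(4)[OF i(1)] _ B(2) i(2)]
      PL(1) B(1) d by (auto simp: I_def)
  obtain c where c: "\<And>e. e \<in> P i \<Longrightarrow> 0 < c e" "(\<Sum>e\<in>P i. c e *\<^sub>R e) = 0"
    using positive_relation[of "P i"] block[OF i(1)] by auto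
  have "0 = u \<bullet> (\<Sum>e\<in>P i. c e *\<^sub>R e)"
    by (simp add: c(2))
  also have "\<dots> = (\<Sum>e\<in>P i. c e * (u \<bullet> e))"
    by (simp add: inner_sum_right)
  also have "\<dots> = c d * (u \<bullet> d) + (\<Sum>e\<in>P i - {d}. c e * (u \<bullet> e))"
    using block(1)[OF i(1)] i(2) by (simp add: sum.remove)
  finally have "c d * (u \<bullet> d) + (\<Sum>e\<in>P i - {d}. c e * (u \<bullet> e)) = 0" ..
  moreover have "0 \<le> (\<Sum>e\<in>P i - {d}. c e * (u \<bullet> e))"
    using rest u c(1) by (intro sum_nonneg mult_nonneg_nonneg) (auto simp: less_imp_le)
  ultimately have "c d * (u \<bullet> d) \<le> 0"
    by linarith
  then show ?thesis
    using c(1)[OF i(2)] by (simp add: mult_le_0_iff)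
qed

section \<open>Minimisers of the maximal cosine\<close>

lemma max_cosine_unit:
  assumes "\<forall>d\<in>D. norm d = 1"
  shows "max_cosine D u = Max ((\<bullet>) u ` D)"
  unfolding max_cosine_def using assms by (intro arg_cong[where f = Max] image_cong) auto

text \<open>A unit vector \<open>u\<close> is itself a nonnegative combination of \<open>D\<close>, and \<open>u \<bullet> u = 1\<close> would be
  impossible if all inner products with \<open>D\<close> were nonpositive.\<close>

lemma max_cosine_pos:
  fixes D :: "'a::euclidean_space set"
  assumes "positive_basis UNIV D" "norm u = 1"
  shows "0 < max_cosine D u"
proof -
  have D: "finite D" "\<forall>d\<in>D. norm d = 1" "pspan D = UNIV"
    using assms(1) by (auto simp: positive_basis_def)
  then obtain c where c: "\<forall>d\<in>D. 0 \<le> c d" "u = (\<Sum>d\<in>D. c d *\<^sub>R d)"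
    unfolding pspan_def by blast
  have "\<exists>d\<in>D. 0 < u \<bullet> d"
  proof (rule ccontr)
    assume neg: "\<not> ?thesis"
    have "u \<bullet> u = (\<Sum>d\<in>D. c d * (u \<bullet> d))"
      by (subst (2) c(2)) (simp add: inner_sum_right)
    also have "\<dots> \<le> 0"
      using neg c(1) by (intro sum_nonpos mult_nonneg_nonpos) (auto simp: not_less)
    finally show False
      using assms(2) by (simp add: dot_square_norm)
  qed
  then show ?thesis
    unfolding max_cosine_unit[OF D(2)] using D(1) by (subst Max_gr_iff) auto
qed

lemma positive_basis_nonempty:
  fixes D :: "'a::euclidean_space set"
  assumes "positive_basis UNIV D"
  shows "D \<noteq> {}"
proof
  assume "D = {}"
  then have "(UNIV :: 'a set) = {0}"
    using assms by (auto simp: positive_basis_def pspan_def)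
  moreover obtain b :: 'a where "b \<in> Basis"
    using nonempty_Basis by blast
  ultimately show False
    using nonzero_Basis by blast
qed

text \<open>The first-order optimality condition for the cosine measure. Were all active elements
  orthogonal to some \<open>w \<noteq> 0\<close>, with the sign of \<open>w\<close> chosen such that \<open>u \<bullet> w \<ge> 0\<close>, then
  \<open>u + t w\<close> would for small \<open>t > 0\<close> have norm above \<open>1\<close> and inner products at most the old
  maximum. As that maximum is positive, dividing by the norm strictly lowers it.\<close>

lemma active_set_spans:
  fixes D :: "'a::euclidean_space set"
  assumes pb: "positive_basis UNIV D" and u: "norm u = 1"
    and minimal: "\<And>v. norm v = 1 \<Longrightarrow> max_cosine D u \<le> max_cosine D v"
  shows "span {d \<in> D. u \<bullet> d = max_cosine D u} = UNIV"
proof (rule ccontr)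
  define m where "m = max_cosine D u"
  define A where "A = {d \<in> D. u \<bullet> d = m}"
  have D: "finite D" "\<forall>d\<in>D. norm d = 1" "D \<noteq> {}"
    using pb positive_basis_nonempty[OF pb] by (auto simp: positive_basis_def)
  have m: "0 < m" "\<And>d. d \<in> D \<Longrightarrow> u \<bullet> d \<le> m"
    using max_cosine_pos[OF pb u] D(1) by (auto simp: m_def max_cosine_unit[OF D(2)])
  assume "span {d \<in> D. u \<bullet> d = max_cosine D u} \<noteq> UNIV"
  then have "span A \<subset> UNIV"
    by (auto simp: A_def m_def)
  then obtain w0 where w0: "w0 \<noteq> 0" "\<And>y. y \<in> span A \<Longrightarrow> orthogonal w0 y"
    using orthogonal_to_subspace_exists_gen[of A UNIV] by auto
  define w where "w = (if 0 \<le> u \<bullet> w0 then w0 else - w0)"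
  have w: "w \<noteq> 0" "0 \<le> u \<bullet> w" "\<And>a. a \<in> A \<Longrightarrow> w \<bullet> a = 0"
    using w0 by (auto simp: w_def orthogonal_def span_base)
  \<comment> \<open>Inactive inner products stay below \<open>m\<close> under small displacements along \<open>w\<close>.\<close>
  have "\<forall>\<^sub>F t in at_right 0. \<forall>d\<in>D - A. (u + t *\<^sub>R w) \<bullet> d < m"
  proof (rule eventually_ball_finite)
    show "\<forall>d\<in>D - A. \<forall>\<^sub>F t in at_right 0. (u + t *\<^sub>R w) \<bullet> d < m"
    proof
      fix d assume "d \<in> D - A"
      then have "u \<bullet> d < m"
        using m(2)[of d] by (auto simp: A_def)
      moreover have "((\<lambda>t. (u + t *\<^sub>R w) \<bullet> d) \<longlongrightarrow> (u + 0 *\<^sub>R w) \<bullet> d) (at_right (0::real))"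
        by (intro tendsto_intros)
      ultimately show "\<forall>\<^sub>F t in at_right 0. (u + t *\<^sub>R w) \<bullet> d < m"
        by (intro order_tendstoD(2)) auto
    qed
  qed (use D(1) in auto)
  then have "\<forall>\<^sub>F t in at_right 0. 0 < t \<and> (\<forall>d\<in>D - A. (u + t *\<^sub>R w) \<bullet> d < m)"
    by (intro eventually_conj eventually_at_right_less)
  then obtain t :: real where t: "0 < t" "\<And>d. d \<in> D - A \<Longrightarrow> (u + t *\<^sub>R w) \<bullet> d < m"
    using eventually_happens'[of "at_right (0::real)"] trivial_limit_at_right_real by blast
  define v where "v = u + t *\<^sub>R w"
  have v_le: "v \<bullet> d \<le> m" if "d \<in> D" for d
  proof (cases "d \<in> A")
    case True
    then show ?thesis
      using w(3)[OF True] by (simp add: v_def inner_left_distrib A_def)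
  next
    case False
    then show ?thesis
      using t(2)[of d] that by (simp add: v_def)
  qed
  have "u \<bullet> u = 1"
    using u by (simp add: dot_square_norm)
  then have "v \<bullet> v = 1 + 2 * t * (u \<bullet> w) + t\<^sup>2 * (w \<bullet> w)"
    by (simp add: v_def inner_left_distrib inner_right_distrib inner_commute
        power2_eq_square algebra_simps)
  moreover have "0 < t\<^sup>2 * (w \<bullet> w)" "0 \<le> 2 * t * (u \<bullet> w)"
    using t(1) w by auto
  ultimately have "1 < (norm v)\<^sup>2"
    by (simp add: power2_norm_eq_inner)
  then have v_gt: "1 < norm v"
    by (metis abs_norm_cancel abs_square_le_1 not_less)
  define v' where "v' = (1 / norm v) *\<^sub>R v"
  have "norm v' = 1"
    using v_gt by (auto simp: v'_def)
  have "v' \<bullet> d < m" if "d \<in> D" for d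
  proof -
    have "v \<bullet> d < m * norm v"
      using v_le[OF that] m(1) v_gt by (simp add: le_less_trans)
    then show ?thesis
      using v_gt m(1) by (auto simp: v'_def divide_simps)
  qed
  then have "max_cosine D v' < m"
    using D(1,3) by (simp add: max_cosine_unit[OF D(2)])
  then show False
    using minimal[OF \<open>norm v' = 1\<close>] by (simp add: m_def)
qed

section \<open>The unit vector of a basis\<close>

lemma basis_vector_properties:
  fixes B :: "real^'n^'n"
  assumes "span (columns B) = UNIV"
  shows "0 < basis_gamma B" "norm (basis_vector B) = 1"
    and "\<And>d. d \<in> columns B \<Longrightarrow> basis_vector B \<bullet> d = basis_gamma B"
    and "basis_vector B v* B = basis_gamma B *\<^sub>R vec 1"
proof -
  define w where "w = matrix_inv (transpose B) *v (vec 1 :: real^'n)"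
  have w: "w \<bullet> d = 1" if "d \<in> columns B" for d
    using basis_quantities(2)[OF assms] that by (simp add: w_def)
  have "column undefined B \<in> columns B"
    by (auto simp: columns_def)
  then have "w \<noteq> 0"
    using w by force
  moreover have g: "basis_gamma B = 1 / norm w"
    unfolding basis_gamma_def basis_quantities(1)[OF assms] w_def by simp
  moreover have v: "basis_vector B = basis_gamma B *\<^sub>R w"
    by (simp add: basis_vector_def w_def)
  ultimately show "0 < basis_gamma B" "norm (basis_vector B) = 1"
    by simp_all
  show col: "basis_vector B \<bullet> d = basis_gamma B" if "d \<in> columns B" for d
    using w[OF that] by (simp add: v)
  have "(basis_vector B v* B) $ j = basis_vector B \<bullet> column j B" for j
    by (simp add: vector_matrix_mult_def inner_vec_def column_def mult.commute)
  then show "basis_vector B v* B = basis_gamma B *\<^sub>R vec 1"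
    using col by (auto simp: vec_eq_iff columns_def)
qed

text \<open>Two vectors with constant inner product on a basis are proportional; unit length and
  positivity of the constant then leave only one.\<close>

lemma basis_vector_unique:
  fixes B :: "real^'n^'n"
  assumes span: "span (columns B) = UNIV"
    and u: "norm u = 1" "\<And>d. d \<in> columns B \<Longrightarrow> u \<bullet> d = g" "0 < g"
  shows "u = basis_vector B" "g = basis_gamma B"
proof -
  let ?b = "basis_vector B" and ?\<gamma> = "basis_gamma B"
  note b = basis_vector_properties[OF span]
  have "orthogonal (?\<gamma> *\<^sub>R u - g *\<^sub>R ?b) x" for x
    using span b(3) u(2)
    by (intro orthogonal_to_span[of x "columns B"])
      (auto simp: orthogonal_def inner_diff_left)
  then have proportional: "?\<gamma> *\<^sub>R u = g *\<^sub>R ?b"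
    by (metis orthogonal_self right_minus_eq)
  then have "norm (?\<gamma> *\<^sub>R u) = norm (g *\<^sub>R ?b)"
    by simp
  then show g: "g = ?\<gamma>"
    using u b(1,2) by simp
  show "u = ?b"
    using proportional b(1) by (simp add: g)
qed

section \<open>Cosine measure and cosine vector set\<close>

lemma max_cosine_basis_vector:
  fixes D :: "(real^'n) set"
  assumes D: "D \<in> Omega s" and B: "B \<in> bases_in D"
  shows "max_cosine D (basis_vector B) = basis_gamma B"
proof -
  have B': "columns B \<subseteq> D" "span (columns B) = UNIV"
    using B by (auto simp: bases_in_def)
  note b = basis_vector_properties[OF B'(2)]
  have D': "finite D" "\<forall>d\<in>D. norm d = 1"
    using Omega_positive_basis[OF D] by (auto simp: positive_basis_def)
  have "basis_vector B \<bullet> d \<le> basis_gamma B" if "d \<in> D" for d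
  proof (cases "d \<in> columns B")
    case False
    then have "basis_vector B \<bullet> d \<le> 0"
      using inner_nonpos_outside_basis[OF D B' b(3) less_imp_le[OF b(1)]] that by blast
    then show ?thesis
      using b(1) by linarith
  qed (simp add: b(3))
  moreover have "column undefined B \<in> columns B"
    by (auto simp: columns_def)
  then have "basis_gamma B \<in> (\<bullet>) (basis_vector B) ` D"
    using b(3) B'(1) by (force simp: image_iff)
  ultimately show ?thesis
    unfolding max_cosine_unit[OF D'(2)] using D'(1) by (intro Max_eqI) auto
qed

text \<open>The basis is extracted from the active set, on which \<open>u\<close> has constant inner product.\<close>

lemma minimizer_is_basis_vector:
  fixes D :: "(real^'n) set"
  assumes pb: "positive_basis UNIV D" and u: "norm u = 1"
    and minimal: "\<And>v. norm v = 1 \<Longrightarrow> max_cosine D u \<le> max_cosine D v"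
  obtains B where "B \<in> bases_in D" "u = basis_vector B" "max_cosine D u = basis_gamma B"
proof -
  define A where "A = {d \<in> D. u \<bullet> d = max_cosine D u}"
  have "span A = UNIV"
    unfolding A_def using active_set_spans[OF pb u minimal] .
  moreover obtain S where S: "S \<subseteq> A" "independent S" "A \<subseteq> span S"
    using maximal_independent_subset[of A] by blast
  ultimately have "span S = UNIV"
    by (metis span_mono span_span top.extremum_unique)
  then have "S \<in> columns ` bases_in D"
    using S by (auto simp: columns_bases_in A_def)
  then obtain B where B: "B \<in> bases_in D" "columns B = S"
    by auto
  have "u = basis_vector B" "max_cosine D u = basis_gamma B"
    using basis_vector_unique[of B u "max_cosine D u"] \<open>span S = UNIV\<close> B(2) u S(1)
      max_cosine_pos[OF pb u] by (auto simp: A_def)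
  then show thesis
    using that B(1) by blast
qed

lemma finite_bases_in:
  fixes D :: "(real^'n) set"
  assumes "finite D"
  shows "finite (bases_in D)"
proof (rule finite_subset)
  show "bases_in D \<subseteq> (\<lambda>h. \<chi> i j. h j $ i) ` (UNIV \<rightarrow>\<^sub>E D)"
  proof
    fix B assume "B \<in> bases_in D"
    then have "(\<lambda>j. column j B) \<in> UNIV \<rightarrow>\<^sub>E D"
      by (auto simp: bases_in_def columns_def)
    moreover have "B = (\<chi> i j. column j B $ i)"
      by (simp add: column_def vec_eq_iff)
    ultimately show "B \<in> (\<lambda>h. \<chi> i j. h j $ i) ` (UNIV \<rightarrow>\<^sub>E D)"
      by (intro image_eqI[where x = "\<lambda>j. column j B"])
  qed
qed (use assms in \<open>auto intro!: finite_PiE\<close>)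

theorem proposition28:
  fixes D :: "(real^'n) set" and s :: nat
  assumes "D \<in> Omega s"
  shows "(\<forall>B\<in>bases_in D. norm (basis_vector B) = 1 \<and>
            basis_vector B v* B = basis_gamma B *\<^sub>R vec 1) \<and>
         (\<forall>B\<in>bases_in D. \<forall>d\<in>D - columns B. basis_vector B \<bullet> d \<le> 0) \<and>
         cosine_measure D = Min (basis_gamma ` bases_in D) \<and>
         cosine_vector_set D =
           {basis_vector B | B. B \<in> bases_in D \<and> basis_gamma B = cosine_measure D}"
proof (intro conjI ballI)
  have pb: "positive_basis UNIV D"
    using Omega_positive_basis[OF assms] .
  have fin: "finite D"
    using pb by (simp add: positive_basis_def)
  have span: "span (columns B) = UNIV" and sub: "columns B \<subseteq> D" if "B \<in> bases_in D" for B
    using that by (auto simp: bases_in_def)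
  obtain u0 where u0: "norm u0 = 1" "max_cosine D u0 = cosine_measure D"
      "\<And>v. norm v = 1 \<Longrightarrow> max_cosine D u0 \<le> max_cosine D v"
    using cosine_measure_attained[OF fin positive_basis_nonempty[OF pb]] by blast
  show "norm (basis_vector B) = 1" if "B \<in> bases_in D" for B
    using basis_vector_properties(2)[OF span[OF that]] .
  show "basis_vector B v* B = basis_gamma B *\<^sub>R vec 1" if "B \<in> bases_in D" for B
    using basis_vector_properties(4)[OF span[OF that]] .
  show "basis_vector B \<bullet> d \<le> 0" if "B \<in> bases_in D" "d \<in> D - columns B" for B d
    using inner_nonpos_outside_basis[OF assms sub span _ _ that(2)]
      basis_vector_properties[OF span[OF that(1)]] that(1) less_imp_le by blast
  show "cosine_measure D = Min (basis_gamma ` bases_in D)"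
  proof (rule Min_eqI[symmetric])
    show "finite (basis_gamma ` bases_in D)"
      using finite_bases_in[OF fin] by simp
    show "cosine_measure D \<in> basis_gamma ` bases_in D"
      using minimizer_is_basis_vector[OF pb u0(1,3)] u0(2) by (metis imageI)
    show "cosine_measure D \<le> g" if g: "g \<in> basis_gamma ` bases_in D" for g
    proof -
      obtain B where B: "B \<in> bases_in D" "g = basis_gamma B"
        using g by auto
      then show ?thesis
        using u0(3)[of "basis_vector B"] max_cosine_basis_vector[OF assms B(1)]
          basis_vector_properties(2)[OF span[OF B(1)]] u0(2) by simp
    qed
  qed
  show "cosine_vector_set D =
      {basis_vector B | B. B \<in> bases_in D \<and> basis_gamma B = cosine_measure D}"
  proof (intro equalityI subsetI)
    fix u assume "u \<in> cosine_vector_set D"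
    then have u: "norm u = 1" "max_cosine D u = cosine_measure D"
      by (auto simp: cosine_vector_set_def)
    obtain B where "B \<in> bases_in D" "u = basis_vector B" "max_cosine D u = basis_gamma B"
      using minimizer_is_basis_vector[OF pb u(1)] u(2) u0(2,3) by metis
    then show "u \<in> {basis_vector B | B. B \<in> bases_in D \<and> basis_gamma B = cosine_measure D}"
      using u(2) by auto
  next
    fix u assume "u \<in> {basis_vector B | B. B \<in> bases_in D \<and> basis_gamma B = cosine_measure D}"
    then obtain B where "B \<in> bases_in D" "basis_gamma B = cosine_measure D" "u = basis_vector B"
      by auto
    then show "u \<in> cosine_vector_set D"
      using max_cosine_basis_vector[OF assms] basis_vector_properties(2)[OF span]
      by (simp add: cosine_vector_set_def)
  qed
qed

end
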